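(* Let $E$ and $F$ be admissible $*$-trings. Then: (1) There exists a pair $(E_0^r,\langle\cdot,\cdot\rangle_r)$ such that $(E,E_0^r,\langle\cdot,\cdot\rangle_r)$ is an admissible and full (right) basic triple whose associated $*$-tring is $E$. (2) If $\pi:E\to F$ is a homomorphism of $*$-trings, and $(E_0^r,\langle\cdot,\cdot\rangle_r)$ and $(F_0^r,\langle\cdot,\cdot\rangle_r)$ are pairs as in (1) for $E$ and $F$ respectively, then there exists a unique homomorphism of $*$-algebras $\pi_0^r:E_0^r\to F_0^r$ such that $\pi_0^r(\langle x,y\rangle_r)=\langle \pi(x),\pi(y)\rangle_r$ for all $x,y\in E$. Moreover $\pi(xb)=\pi(x)\pi_0^r(b)$ for all $x\in E$, $b\in E_0^r$; that is, $(\pi,\pi_0^r)$ is a homomorphism of basic triples. (3) The pair $(E_0^r,\langle\cdot,\cdot\rangle_r)$ is the unique one (up to canonical isomorphism) such that the triple $(E,E_0^r,\langle\cdot,\cdot\rangle_r)$ is full and admissible with $E$ as associated $*$-tring.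
   Context: A $*$-ternary ring ($*$-tring) is a complex vector space $E$ with a map $(\cdot,\cdot,\cdot):E\times E\times E\to E$, linear in the first and third variables and conjugate linear in the second, such that $((x,y,z),u,v)=(x,(u,z,y),v)=(x,y,(z,u,v))$ for all $x,y,z,u,v\in E$. A homomorphism of $*$-trings is a linear map preserving the ternary products. A $*$-tring $E$ is admissible if $(x,x,x)=0$ implies $x=0$. A (complex) $*$-algebra $A$ is admissible if $a^*a=0$ implies $a=0$. A (right) basic triple is a triple $(E,A,\langle\cdot,\cdot\rangle)$ where $E$ is a complex vector space, $A$ is a $*$-algebra over which $E$ is a right module, and $\langle\cdot,\cdot\rangle:E\times E\to A$ is sesquilinear (conjugate linear in the first variable) with $\langle x,y\rangle a=\langle x,ya\rangle$ and $\langle x,y\rangle^*=\langle y,x\rangle$ for all $x,y\in E$, $a\in A$. Its associated $*$-tring is $E$ with the ternary product $(x,y,z)=x\langle y,z\rangle$. The triple is admissible if $A$ is admissible, and full if $\mathrm{span}\{\langle x,y\rangle: x,y\in E\}=A$. A homomorphism of basic triples $(E,A,\langle\cdot,\cdot\rangle_A)\to(F,B,\langle\cdot,\cdot\rangle_B)$ is a pair $(\varphi,\psi)$ with $\varphi:E\to F$ linear, $\psi:A\to B$ a homomorphism of $*$-algebras, and $\varphi(xa)=\varphi(x)\psi(a)$ for all $x\in E$, $a\in A$. In (3), canonical isomorphism means a $*$-isomorphism of the algebras carrying one sesquilinear map to the other and compatible with the module actions on $E$. *)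

theory Defs
  imports Complex_Main "HOL-Algebra.Algebraic_Closure_Type"
begin

abbreviation complex_ring :: "complex ring"
  where "complex_ring \<equiv> ring_of_type_algebra"

text \<open>
  A complex vector space is a structure \<open>E\<close> with \<^prop>\<open>module complex_ring E\<close>.
  As usual in HOL-Algebra, the multiplication and unit fields that the record of a module inherits
  from the record of a ring are ignored unless they are mentioned explicitly.
\<close>

definition complex_linear ::
    "(complex, 'e, 'm) module_scheme \<Rightarrow> (complex, 'f, 'n) module_scheme \<Rightarrow> ('e \<Rightarrow> 'f) \<Rightarrow> bool"
  where "complex_linear E F f \<longleftrightarrow>
    f \<in> carrier E \<rightarrow> carrier F \<and>
    (\<forall>x \<in> carrier E. \<forall>y \<in> carrier E. f (x \<oplus>\<^bsub>E\<^esub> y) = f x \<oplus>\<^bsub>F\<^esub> f y) \<and>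
    (\<forall>c. \<forall>x \<in> carrier E. f (c \<odot>\<^bsub>E\<^esub> x) = c \<odot>\<^bsub>F\<^esub> f x)"

definition conjugate_linear ::
    "(complex, 'e, 'm) module_scheme \<Rightarrow> (complex, 'f, 'n) module_scheme \<Rightarrow> ('e \<Rightarrow> 'f) \<Rightarrow> bool"
  where "conjugate_linear E F f \<longleftrightarrow>
    f \<in> carrier E \<rightarrow> carrier F \<and>
    (\<forall>x \<in> carrier E. \<forall>y \<in> carrier E. f (x \<oplus>\<^bsub>E\<^esub> y) = f x \<oplus>\<^bsub>F\<^esub> f y) \<and>
    (\<forall>c. \<forall>x \<in> carrier E. f (c \<odot>\<^bsub>E\<^esub> x) = cnj c \<odot>\<^bsub>F\<^esub> f x)"

definition complex_span :: "(complex, 'e, 'm) module_scheme \<Rightarrow> 'e set \<Rightarrow> 'e set"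
  where "complex_span E S = (\<lambda>H. submodule H complex_ring E) hull S"


section \<open>Ternary rings with involution\<close>

record 'e star_tring = "(complex, 'e) module" +
  tprod :: "'e \<Rightarrow> 'e \<Rightarrow> 'e \<Rightarrow> 'e"

locale star_tring = module complex_ring E for E :: "'e star_tring" (structure) +
  assumes tprod_linear1: "\<lbrakk>y \<in> carrier E; z \<in> carrier E\<rbrakk>
      \<Longrightarrow> complex_linear E E (\<lambda>x. tprod E x y z)"
    and tprod_conj_linear2: "\<lbrakk>x \<in> carrier E; z \<in> carrier E\<rbrakk>
      \<Longrightarrow> conjugate_linear E E (\<lambda>y. tprod E x y z)"
    and tprod_linear3: "\<lbrakk>x \<in> carrier E; y \<in> carrier E\<rbrakk>
      \<Longrightarrow> complex_linear E E (\<lambda>z. tprod E x y z)"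
    and tprod_assoc1:
      "\<lbrakk>x \<in> carrier E; y \<in> carrier E; z \<in> carrier E; u \<in> carrier E; v \<in> carrier E\<rbrakk>
      \<Longrightarrow> tprod E (tprod E x y z) u v = tprod E x (tprod E u z y) v"
    and tprod_assoc2:
      "\<lbrakk>x \<in> carrier E; y \<in> carrier E; z \<in> carrier E; u \<in> carrier E; v \<in> carrier E\<rbrakk>
      \<Longrightarrow> tprod E x (tprod E u z y) v = tprod E x y (tprod E z u v)"

locale admissible_star_tring = star_tring +
  assumes tprod_eq_zero: "\<lbrakk>x \<in> carrier E; tprod E x x x = \<zero>\<rbrakk> \<Longrightarrow> x = \<zero>"

definition star_tring_hom :: "'e star_tring \<Rightarrow> 'f star_tring \<Rightarrow> ('e \<Rightarrow> 'f) \<Rightarrow> bool"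
  where "star_tring_hom E F \<pi> \<longleftrightarrow>
    complex_linear E F \<pi> \<and>
    (\<forall>x \<in> carrier E. \<forall>y \<in> carrier E. \<forall>z \<in> carrier E.
      \<pi> (tprod E x y z) = tprod F (\<pi> x) (\<pi> y) (\<pi> z))"


section \<open>Algebras with involution\<close>

text \<open>These algebras need not have a unit; the inherited field \<open>one\<close> is not used.\<close>

record 'a star_algebra = "(complex, 'a) module" +
  adj :: "'a \<Rightarrow> 'a"

locale star_algebra = module complex_ring A for A :: "'a star_algebra" (structure) +
  assumes mult_linear1: "b \<in> carrier A \<Longrightarrow> complex_linear A A (\<lambda>a. a \<otimes> b)"
    and mult_linear2: "a \<in> carrier A \<Longrightarrow> complex_linear A A (\<lambda>b. a \<otimes> b)"
    and mult_assoc: "\<lbrakk>a \<in> carrier A; b \<in> carrier A; c \<in> carrier A\<rbrakk>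
      \<Longrightarrow> (a \<otimes> b) \<otimes> c = a \<otimes> (b \<otimes> c)"
    and adj_conj_linear: "conjugate_linear A A (adj A)"
    and adj_adj: "a \<in> carrier A \<Longrightarrow> adj A (adj A a) = a"
    and adj_mult: "\<lbrakk>a \<in> carrier A; b \<in> carrier A\<rbrakk> \<Longrightarrow> adj A (a \<otimes> b) = adj A b \<otimes> adj A a"

locale admissible_star_algebra = star_algebra +
  assumes adj_mult_self_eq_zero: "\<lbrakk>a \<in> carrier A; adj A a \<otimes> a = \<zero>\<rbrakk> \<Longrightarrow> a = \<zero>"

definition star_algebra_hom :: "'a star_algebra \<Rightarrow> 'b star_algebra \<Rightarrow> ('a \<Rightarrow> 'b) \<Rightarrow> bool"
  where "star_algebra_hom A B \<psi> \<longleftrightarrow>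
    complex_linear A B \<psi> \<and>
    (\<forall>a \<in> carrier A. \<forall>b \<in> carrier A. \<psi> (a \<otimes>\<^bsub>A\<^esub> b) = \<psi> a \<otimes>\<^bsub>B\<^esub> \<psi> b) \<and>
    (\<forall>a \<in> carrier A. \<psi> (adj A a) = adj B (\<psi> a))"


section \<open>Right basic triples\<close>

text \<open>
  The right module action \<open>act x a\<close> (that is, \<open>x a\<close>), which the notation \<open>(E, A, \<langle>\<cdot>,\<cdot>\<rangle>)\<close> leaves
  implicit, is an explicit parameter; \<open>ip x y\<close> is \<open>\<langle>x, y\<rangle>\<close>. A right module over a complex algebra
  is understood to have a complex bilinear action.
\<close>

locale basic_triple =
    E: module complex_ring E + A: star_algebra A
    for E :: "(complex, 'e, 'm) module_scheme" and A :: "'a star_algebra" +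
  fixes act :: "'e \<Rightarrow> 'a \<Rightarrow> 'e" and ip :: "'e \<Rightarrow> 'e \<Rightarrow> 'a"
  assumes act_linear1: "a \<in> carrier A \<Longrightarrow> complex_linear E E (\<lambda>x. act x a)"
    and act_linear2: "x \<in> carrier E \<Longrightarrow> complex_linear A E (\<lambda>a. act x a)"
    and act_mult: "\<lbrakk>x \<in> carrier E; a \<in> carrier A; b \<in> carrier A\<rbrakk>
      \<Longrightarrow> act (act x a) b = act x (a \<otimes>\<^bsub>A\<^esub> b)"
    and ip_conj_linear1: "y \<in> carrier E \<Longrightarrow> conjugate_linear E A (\<lambda>x. ip x y)"
    and ip_linear2: "x \<in> carrier E \<Longrightarrow> complex_linear E A (\<lambda>y. ip x y)"
    and ip_act: "\<lbrakk>x \<in> carrier E; y \<in> carrier E; a \<in> carrier A\<rbrakk>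
      \<Longrightarrow> ip x y \<otimes>\<^bsub>A\<^esub> a = ip x (act y a)"
    and adj_ip: "\<lbrakk>x \<in> carrier E; y \<in> carrier E\<rbrakk> \<Longrightarrow> adj A (ip x y) = ip y x"

locale admissible_basic_triple = basic_triple + A: admissible_star_algebra A

locale full_basic_triple = basic_triple +
  assumes full: "complex_span A {ip x y | x y. x \<in> carrier E \<and> y \<in> carrier E} = carrier A"

definition associated_tprod :: "('e \<Rightarrow> 'a \<Rightarrow> 'e) \<Rightarrow> ('e \<Rightarrow> 'e \<Rightarrow> 'a) \<Rightarrow> 'e \<Rightarrow> 'e \<Rightarrow> 'e \<Rightarrow> 'e"
  where "associated_tprod act ip x y z = act x (ip y z)"

text \<open>Since \<open>E\<close> and the triple share the vector space, only the ternary products are compared.\<close>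

definition adm_full_triple_of ::
    "'e star_tring \<Rightarrow> 'a star_algebra \<Rightarrow> ('e \<Rightarrow> 'a \<Rightarrow> 'e) \<Rightarrow> ('e \<Rightarrow> 'e \<Rightarrow> 'a) \<Rightarrow> bool"
  where "adm_full_triple_of E A act ip \<longleftrightarrow>
    admissible_basic_triple E A act ip \<and> full_basic_triple E A act ip \<and>
    (\<forall>x \<in> carrier E. \<forall>y \<in> carrier E. \<forall>z \<in> carrier E.
      associated_tprod act ip x y z = tprod E x y z)"

text \<open>The sesquilinear maps play no role in this definition.\<close>

definition basic_triple_hom ::
    "(complex, 'e, 'm) module_scheme \<Rightarrow> 'a star_algebra \<Rightarrow> ('e \<Rightarrow> 'a \<Rightarrow> 'e) \<Rightarrow>
     (complex, 'f, 'n) module_scheme \<Rightarrow> 'b star_algebra \<Rightarrow> ('f \<Rightarrow> 'b \<Rightarrow> 'f) \<Rightarrow>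
     ('e \<Rightarrow> 'f) \<Rightarrow> ('a \<Rightarrow> 'b) \<Rightarrow> bool"
  where "basic_triple_hom E A actA F B actB \<phi> \<psi> \<longleftrightarrow>
    complex_linear E F \<phi> \<and> star_algebra_hom A B \<psi> \<and>
    (\<forall>x \<in> carrier E. \<forall>a \<in> carrier A. \<phi> (actA x a) = actB (\<phi> x) (\<psi> a))"

definition canonical_iso ::
    "(complex, 'e, 'm) module_scheme \<Rightarrow>
     'a star_algebra \<Rightarrow> ('e \<Rightarrow> 'a \<Rightarrow> 'e) \<Rightarrow> ('e \<Rightarrow> 'e \<Rightarrow> 'a) \<Rightarrow>
     'b star_algebra \<Rightarrow> ('e \<Rightarrow> 'b \<Rightarrow> 'e) \<Rightarrow> ('e \<Rightarrow> 'e \<Rightarrow> 'b) \<Rightarrow> ('a \<Rightarrow> 'b) \<Rightarrow> bool"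
  where "canonical_iso E A actA ipA B actB ipB \<psi> \<longleftrightarrow>
    star_algebra_hom A B \<psi> \<and> bij_betw \<psi> (carrier A) (carrier B) \<and>
    (\<forall>x \<in> carrier E. \<forall>y \<in> carrier E. \<psi> (ipA x y) = ipB x y) \<and>
    (\<forall>x \<in> carrier E. \<forall>a \<in> carrier A. actA x a = actB x (\<psi> a))"

end

theory Submission
  imports Defs
begin

text \<open>
  The algebra \<open>E\<^sub>0\<^sup>r\<close> is spanned by the right multiplications \<open>x \<mapsto> (x, y, z)\<close>. They lie in the algebra
  of all operators \<open>T\<close> that have an adjoint \<open>S\<close> in the sense that \<open>(T w, x, u) = (w, S x, u)\<close>.
  Admissibility of \<open>E\<close> makes the ternary product nondegenerate in its second and third variables;
  hence adjoints are unique and symmetric, adjointable operators are linear and satisfy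
  \<open>T (x, y, z) = (x, y, T z)\<close>, and \<open>T (S x) = 0\<close> for all \<open>x\<close> gives \<open>(S x, S x, S x) = (T (S x), x, S x) = 0\<close>,
  so that the algebra is admissible.

  A homomorphism \<open>\<pi>\<close> induces the relation spanned by the pairs \<open>(\<langle>x, y\<rangle>, \<langle>\<pi> x, \<pi> y\<rangle>)\<close>. It is total by
  fullness, compatible with all operations, and single valued because the target is admissible.
  For \<open>\<pi> = id\<close> the converse relation is of the same kind, which gives uniqueness of the pair.
\<close>

section \<open>Complex linear algebra\<close>

lemma complex_ring_simps [simp]:
  "carrier complex_ring = UNIV" "\<zero>\<^bsub>complex_ring\<^esub> = 0" "\<one>\<^bsub>complex_ring\<^esub> = 1"
  "a \<oplus>\<^bsub>complex_ring\<^esub> b = a + b" "a \<otimes>\<^bsub>complex_ring\<^esub> b = a * b"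
  by (simp_all add: ring_of_type_algebra_def)

lemma complex_minus_one [simp]: "\<ominus>\<^bsub>complex_ring\<^esub> (1 :: complex) = - 1"
proof -
  interpret cring complex_ring
    by (rule cring_from_type_algebra)
  show ?thesis
    by (rule minus_equality) simp_all
qed

section \<open>Complex modules, their submodules and spans\<close>

locale complex_module = module complex_ring M for M (structure)
begin

lemma smult_add_scalar: "x \<in> carrier M \<Longrightarrow> (a + b) \<odot> x = a \<odot> x \<oplus> b \<odot> x"
  using smult_l_distr[of a b x] by simp

lemma smult_mult_scalar: "x \<in> carrier M \<Longrightarrow> (a * b) \<odot> x = a \<odot> (b \<odot> x)"
  using smult_assoc1[of a b x] by simp

lemma smult_zero_scalar: "x \<in> carrier M \<Longrightarrow> 0 \<odot> x = \<zero>"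
  using smult_l_null[of x] by simp

lemma smult_minus_one: "x \<in> carrier M \<Longrightarrow> (- 1) \<odot> x = \<ominus> x"
  using smult_l_minus[of 1 x] smult_one[of x] by simp

lemma eq_if_diff_eq_zero: "\<lbrakk>x \<in> carrier M; y \<in> carrier M; x \<ominus> y = \<zero>\<rbrakk> \<Longrightarrow> x = y"
  using M.minus_equality[of x "\<ominus> y"] by (simp add: a_minus_def)

text \<open>Closure under negation is automatic over the complex numbers: negation is scaling by
  -1.\<close>

lemma complex_submoduleI:
  assumes "H \<subseteq> carrier M" "\<zero> \<in> H"
    and "\<And>a b. \<lbrakk>a \<in> H; b \<in> H\<rbrakk> \<Longrightarrow> a \<oplus> b \<in> H"
    and "\<And>c a. a \<in> H \<Longrightarrow> c \<odot> a \<in> H"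
  shows "submodule H complex_ring M"
proof (rule submoduleI)
  fix a assume "a \<in> H"
  then show "\<ominus> a \<in> H"
    using assms(1) assms(4)[of a "- 1"] smult_minus_one by auto
qed (use assms in auto)

lemma span_superset: "x \<in> S \<Longrightarrow> x \<in> complex_span M S"
  unfolding complex_span_def by (rule hull_inc)

lemma span_subset_carrier: "S \<subseteq> carrier M \<Longrightarrow> complex_span M S \<subseteq> carrier M"
  unfolding complex_span_def by (intro hull_minimal carrier_is_submodule)

lemma span_zero: "\<zero> \<in> complex_span M S"
  unfolding complex_span_def hull_def
  using subgroup.one_closed[OF submodule.axioms(1)] by fastforce

lemma span_add:
  "\<lbrakk>a \<in> complex_span M S; b \<in> complex_span M S\<rbrakk> \<Longrightarrow> a \<oplus> b \<in> complex_span M S"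
  unfolding complex_span_def hull_def by (auto simp: submoduleE(5))

lemma span_smult: "a \<in> complex_span M S \<Longrightarrow> c \<odot> a \<in> complex_span M S"
  unfolding complex_span_def hull_def by (auto simp: submoduleE(4))

lemma submodule_span:
  assumes "S \<subseteq> carrier M"
  shows "submodule (complex_span M S) complex_ring M"
  using span_subset_carrier[OF assms] span_zero span_add span_smult
  by (rule complex_submoduleI)

text \<open>The elements of the span that satisfy \<open>P\<close> form a submodule containing
  \<open>S\<close>, and the hull is the least such. Membership in the span is kept in the hypotheses
  so that carrier side conditions can be discharged.\<close>

lemma span_induct [consumes 2, case_names base zero add smult]:
  assumes a: "a \<in> complex_span M S" and S: "S \<subseteq> carrier M"
    and base: "\<And>x. x \<in> S \<Longrightarrow> P x"
    and zero: "P \<zero>"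
    and add: "\<And>x y. \<lbrakk>x \<in> complex_span M S; y \<in> complex_span M S; P x; P y\<rbrakk> \<Longrightarrow> P (x \<oplus> y)"
    and smult: "\<And>c x. \<lbrakk>x \<in> complex_span M S; P x\<rbrakk> \<Longrightarrow> P (c \<odot> x)"
  shows "P a"
proof -
  let ?H = "{x \<in> complex_span M S. P x}"
  have "submodule ?H complex_ring M"
    using span_subset_carrier[OF S] zero add smult
    by (intro complex_submoduleI) (auto intro: span_zero span_add span_smult)
  moreover have "S \<subseteq> ?H"
    using base by (auto intro: span_superset)
  ultimately have "complex_span M S \<subseteq> ?H"
    unfolding complex_span_def[of M S] by (intro hull_minimal)
  with a show ?thesis by auto
qed

lemma module_span:
  assumes "S \<subseteq> carrier M"
  shows "module complex_ring (M\<lparr>carrier := complex_span M S\<rparr>)"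
  using submodule.submodule_is_module[OF submodule_span[OF assms]] module_axioms .

text \<open>Needed for fullness of an algebra obtained by cutting a larger one down to a span: there
  the span has to be taken inside the smaller structure.\<close>

lemma span_in_span:
  assumes "S \<subseteq> carrier M"
  shows "complex_span (M\<lparr>carrier := complex_span M S\<rparr>) S = complex_span M S"
    (is "complex_span ?N S = _")
proof -
  interpret N: complex_module ?N
    using module_span[OF assms] by (simp add: complex_module_def)
  have "S \<subseteq> carrier ?N"
    by (auto intro: span_superset)
  moreover have "x \<in> complex_span ?N S" if "x \<in> complex_span M S" for x
    using that assms
  proof (induction rule: span_induct)
    case (base x)
    then show ?case by (rule N.span_superset)
  next
    case zero
    show ?case using N.span_zero by simp
  next
    case (add x y)
    then show ?case using N.span_add by simp
  next
    case (smult c x)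
    then show ?case using N.span_smult by simp
  qed
  ultimately show ?thesis
    using N.span_subset_carrier by auto
qed

end

section \<open>Linear and conjugate linear maps\<close>

lemma complex_linearD:
  assumes "complex_linear E F f"
  shows "x \<in> carrier E \<Longrightarrow> f x \<in> carrier F"
    and "\<lbrakk>x \<in> carrier E; y \<in> carrier E\<rbrakk> \<Longrightarrow> f (x \<oplus>\<^bsub>E\<^esub> y) = f x \<oplus>\<^bsub>F\<^esub> f y"
    and "x \<in> carrier E \<Longrightarrow> f (c \<odot>\<^bsub>E\<^esub> x) = c \<odot>\<^bsub>F\<^esub> f x"
  using assms by (auto simp: complex_linear_def)

lemma conjugate_linearD:
  assumes "conjugate_linear E F f"
  shows "x \<in> carrier E \<Longrightarrow> f x \<in> carrier F"
    and "\<lbrakk>x \<in> carrier E; y \<in> carrier E\<rbrakk> \<Longrightarrow> f (x \<oplus>\<^bsub>E\<^esub> y) = f x \<oplus>\<^bsub>F\<^esub> f y"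
    and "x \<in> carrier E \<Longrightarrow> f (c \<odot>\<^bsub>E\<^esub> x) = cnj c \<odot>\<^bsub>F\<^esub> f x"
  using assms by (auto simp: conjugate_linear_def)

text \<open>The zero vector is 0 times itself, and 0 is its own conjugate, so one argument serves
  both kinds of map.\<close>

lemma linear_zero:
  assumes E: "module complex_ring E" and F: "module complex_ring F"
    and f: "complex_linear E F f \<or> conjugate_linear E F f"
  shows "f \<zero>\<^bsub>E\<^esub> = \<zero>\<^bsub>F\<^esub>"
proof -
  interpret E: complex_module E using E by (simp add: complex_module_def)
  interpret F: complex_module F using F by (simp add: complex_module_def)
  have "f (0 \<odot>\<^bsub>E\<^esub> \<zero>\<^bsub>E\<^esub>) = 0 \<odot>\<^bsub>F\<^esub> f \<zero>\<^bsub>E\<^esub>" "f \<zero>\<^bsub>E\<^esub> \<in> carrier F"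
    using f E.zero_closed by (auto simp: complex_linear_def conjugate_linear_def simp del: E.smult_r_null)
  then show ?thesis
    by (simp add: E.smult_zero_scalar F.smult_zero_scalar)
qed

lemma linear_eq_on_span:
  assumes E: "module complex_ring E" and F: "module complex_ring F"
    and f: "complex_linear E F f" and g: "complex_linear E F g"
    and S: "S \<subseteq> carrier E" and eq: "\<And>x. x \<in> S \<Longrightarrow> f x = g x"
    and x: "x \<in> complex_span E S"
  shows "f x = g x"
proof -
  interpret E: complex_module E using E by (simp add: complex_module_def)
  have span: "y \<in> carrier E" if "y \<in> complex_span E S" for y
    using that E.span_subset_carrier[OF S] by auto
  from x S show ?thesis
    by (induction rule: E.span_induct)
      (simp_all add: eq span complex_linearD[OF f] complex_linearD[OF g]
        linear_zero[OF E F disjI1] f g)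
qed


section \<open>Spans that are star-subalgebras\<close>

context star_algebra
begin

sublocale complex_module A
  by (simp add: complex_module_def module_axioms)

lemma mult_add_left:
  "\<lbrakk>a \<in> carrier A; b \<in> carrier A; c \<in> carrier A\<rbrakk> \<Longrightarrow> (a \<oplus> b) \<otimes> c = a \<otimes> c \<oplus> b \<otimes> c"
  using complex_linearD(2)[OF mult_linear1] .

lemma mult_add_right:
  "\<lbrakk>a \<in> carrier A; b \<in> carrier A; c \<in> carrier A\<rbrakk> \<Longrightarrow> a \<otimes> (b \<oplus> c) = a \<otimes> b \<oplus> a \<otimes> c"
  using complex_linearD(2)[OF mult_linear2] .

lemma mult_smult_left:
  "\<lbrakk>a \<in> carrier A; b \<in> carrier A\<rbrakk> \<Longrightarrow> (c \<odot> a) \<otimes> b = c \<odot> (a \<otimes> b)"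
  using complex_linearD(3)[OF mult_linear1] .

lemma mult_smult_right:
  "\<lbrakk>a \<in> carrier A; b \<in> carrier A\<rbrakk> \<Longrightarrow> a \<otimes> (c \<odot> b) = c \<odot> (a \<otimes> b)"
  using complex_linearD(3)[OF mult_linear2] .

lemma mult_zero_left: "a \<in> carrier A \<Longrightarrow> \<zero> \<otimes> a = \<zero>"
  using linear_zero[OF module_axioms module_axioms disjI1, OF mult_linear1] .

lemma mult_zero_right: "a \<in> carrier A \<Longrightarrow> a \<otimes> \<zero> = \<zero>"
  using linear_zero[OF module_axioms module_axioms disjI1, OF mult_linear2] .

lemmas adj_add = conjugate_linearD(2)[OF adj_conj_linear]
  and adj_smult = conjugate_linearD(3)[OF adj_conj_linear]

lemma adj_zero: "adj A \<zero> = \<zero>"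
  using linear_zero[OF module_axioms module_axioms disjI2, OF adj_conj_linear] .

text \<open>Closure of generators extends by bilinearity in two inductions: first over the right
  factor against a fixed generator, then over the left factor against any element of the
  span.\<close>

lemma star_algebra_span:
  assumes S: "S \<subseteq> carrier A"
    and mult: "\<And>a b. \<lbrakk>a \<in> S; b \<in> S\<rbrakk> \<Longrightarrow> a \<otimes> b \<in> complex_span A S"
    and adj: "\<And>a. a \<in> S \<Longrightarrow> adj A a \<in> complex_span A S"
  shows "star_algebra (A\<lparr>carrier := complex_span A S\<rparr>)"
proof -
  have car: "a \<in> carrier A" if "a \<in> complex_span A S" for a
    using that span_subset_carrier[OF S] by auto
  have mult_gen: "a \<otimes> b \<in> complex_span A S" if a: "a \<in> S" and b: "b \<in> complex_span A S" for a b
    using b S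
    by (induction rule: span_induct)
      (use a S in \<open>auto simp: mult mult_zero_right mult_add_right mult_smult_right car subsetD
        intro: span_zero span_add span_smult\<close>)
  have mult_span: "a \<otimes> b \<in> complex_span A S"
    if "a \<in> complex_span A S" "b \<in> complex_span A S" for a b
    using that(1) S
    by (induction rule: span_induct)
      (use that(2) in \<open>auto simp: mult_gen mult_zero_left mult_add_left mult_smult_left car
        intro: span_zero span_add span_smult\<close>)
  have adj_span: "adj A a \<in> complex_span A S" if "a \<in> complex_span A S" for a
    using that S
    by (induction rule: span_induct)
      (auto simp: adj adj_zero adj_add adj_smult car intro: span_zero span_add span_smult)
  show ?thesis
    by (intro star_algebra.intro star_algebra_axioms.intro module_span S)
      (auto simp: complex_linear_def conjugate_linear_def car mult_span adj_span mult_add_left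
        mult_add_right mult_smult_left mult_smult_right mult_assoc adj_add adj_smult adj_adj adj_mult)
qed

end

lemma (in admissible_star_algebra) admissible_star_algebra_span:
  assumes S: "S \<subseteq> carrier A"
    and "star_algebra (A\<lparr>carrier := complex_span A S\<rparr>)"
  shows "admissible_star_algebra (A\<lparr>carrier := complex_span A S\<rparr>)"
  using assms(2) span_subset_carrier[OF S] adj_mult_self_eq_zero
  by (intro admissible_star_algebra.intro admissible_star_algebra_axioms.intro) auto


section \<open>The algebra of adjointable operators\<close>

context star_tring
begin

sublocale complex_module E
  by (simp add: complex_module_def module_axioms)

lemma tprod_closed:
  "\<lbrakk>x \<in> carrier E; y \<in> carrier E; z \<in> carrier E\<rbrakk> \<Longrightarrow> tprod E x y z \<in> carrier E"
  using complex_linearD(1)[OF tprod_linear1] .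

lemmas tprod_add1 = complex_linearD(2)[OF tprod_linear1]
  and tprod_add2 = conjugate_linearD(2)[OF tprod_conj_linear2]
  and tprod_add3 = complex_linearD(2)[OF tprod_linear3]
  and tprod_smult1 = complex_linearD(3)[OF tprod_linear1]
  and tprod_smult2 = conjugate_linearD(3)[OF tprod_conj_linear2]
  and tprod_smult3 = complex_linearD(3)[OF tprod_linear3]

lemmas tprod_zero1 = linear_zero[OF module_axioms module_axioms disjI1, OF tprod_linear1]
  and tprod_zero2 = linear_zero[OF module_axioms module_axioms disjI2, OF tprod_conj_linear2]

lemma tprod_minus2:
  "\<lbrakk>x \<in> carrier E; y \<in> carrier E; z \<in> carrier E\<rbrakk> \<Longrightarrow> tprod E x (\<ominus> y) z = \<ominus> tprod E x y z"
  using tprod_smult2[of x z y "- 1"] by (simp add: smult_minus_one tprod_closed)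

lemma tprod_minus3:
  "\<lbrakk>x \<in> carrier E; y \<in> carrier E; z \<in> carrier E\<rbrakk> \<Longrightarrow> tprod E x y (\<ominus> z) = \<ominus> tprod E x y z"
  using tprod_smult3[of x y z "- 1"] by (simp add: smult_minus_one tprod_closed)

end

context admissible_star_tring
begin

text \<open>For d = p - q, the cube (d, d, d) expands to (d, p, d) - (d, q, d) = 0, so admissibility
  forces d = 0.\<close>

lemma tprod_middle_cancel:
  assumes p: "p \<in> carrier E" and q: "q \<in> carrier E"
    and eq: "\<And>a b. \<lbrakk>a \<in> carrier E; b \<in> carrier E\<rbrakk> \<Longrightarrow> tprod E a p b = tprod E a q b"
  shows "p = q"
proof -
  let ?d = "p \<oplus> \<ominus> q"
  have d: "?d \<in> carrier E" using p q by simp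
  have "tprod E ?d ?d ?d = tprod E ?d p ?d \<oplus> \<ominus> tprod E ?d q ?d"
    by (simp add: tprod_add2[OF d d] tprod_minus2[OF d _ d] p q)
  also have "\<dots> = \<zero>"
    using eq[OF d d] d q by (simp add: r_neg tprod_closed)
  finally have "?d = \<zero>"
    by (rule tprod_eq_zero[OF d])
  then show ?thesis
    using p q by (simp add: eq_if_diff_eq_zero a_minus_def)
qed

text \<open>As in the middle variable, now expanding the third entry of (d, d, d).\<close>

lemma tprod_right_cancel:
  assumes p: "p \<in> carrier E" and q: "q \<in> carrier E"
    and eq: "\<And>a b. \<lbrakk>a \<in> carrier E; b \<in> carrier E\<rbrakk> \<Longrightarrow> tprod E a b p = tprod E a b q"
  shows "p = q"
proof -
  let ?d = "p \<oplus> \<ominus> q"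
  have d: "?d \<in> carrier E" using p q by simp
  have "tprod E ?d ?d ?d = tprod E ?d ?d p \<oplus> \<ominus> tprod E ?d ?d q"
    by (simp add: tprod_add3[OF d d] tprod_minus3[OF d d] p q)
  also have "\<dots> = \<zero>"
    using eq[OF d d] d q by (simp add: r_neg tprod_closed)
  finally have "?d = \<zero>"
    by (rule tprod_eq_zero[OF d])
  then show ?thesis
    using p q by (simp add: eq_if_diff_eq_zero a_minus_def)
qed

end

section \<open>Adjoint pairs of operators\<close>

text \<open>The maps u \<mapsto> (w, x, u) play the part of an operator-valued inner product of w
  and x. Extensional function spaces make operators equal as soon as they agree on the
  carrier.\<close>

definition is_adjoint :: "'e star_tring \<Rightarrow> ('e \<Rightarrow> 'e) \<Rightarrow> ('e \<Rightarrow> 'e) \<Rightarrow> bool"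
  where "is_adjoint E T S \<longleftrightarrow>
    T \<in> carrier E \<rightarrow>\<^sub>E carrier E \<and> S \<in> carrier E \<rightarrow>\<^sub>E carrier E \<and>
    (\<forall>w \<in> carrier E. \<forall>x \<in> carrier E. \<forall>u \<in> carrier E.
      tprod E (T w) x u = tprod E w (S x) u)"

text \<open>Operators act on the right of their argument, so the product is composition in reverse order.\<close>

definition adjointable_algebra :: "'e star_tring \<Rightarrow> ('e \<Rightarrow> 'e) star_algebra"
  where "adjointable_algebra E =
    \<lparr>carrier = {T. \<exists>S. is_adjoint E T S},
     monoid.mult = (\<lambda>T U. \<lambda>x \<in> carrier E. U (T x)),
     one = (\<lambda>x \<in> carrier E. x),
     ring.zero = (\<lambda>x \<in> carrier E. \<zero>\<^bsub>E\<^esub>),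
     add = (\<lambda>T U. \<lambda>x \<in> carrier E. T x \<oplus>\<^bsub>E\<^esub> U x),
     module.smult = (\<lambda>c T. \<lambda>x \<in> carrier E. c \<odot>\<^bsub>E\<^esub> T x),
     adj = (\<lambda>T. THE S. is_adjoint E T S)\<rparr>"

definition right_mult :: "'e star_tring \<Rightarrow> 'e \<Rightarrow> 'e \<Rightarrow> 'e \<Rightarrow> 'e"
  where "right_mult E y z = (\<lambda>x \<in> carrier E. tprod E x y z)"

lemma adjointable_algebra_simps [simp]:
  "carrier (adjointable_algebra E) = {T. \<exists>S. is_adjoint E T S}"
  "T \<otimes>\<^bsub>adjointable_algebra E\<^esub> U = (\<lambda>x \<in> carrier E. U (T x))"
  "\<zero>\<^bsub>adjointable_algebra E\<^esub> = (\<lambda>x \<in> carrier E. \<zero>\<^bsub>E\<^esub>)"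
  "T \<oplus>\<^bsub>adjointable_algebra E\<^esub> U = (\<lambda>x \<in> carrier E. T x \<oplus>\<^bsub>E\<^esub> U x)"
  "c \<odot>\<^bsub>adjointable_algebra E\<^esub> T = (\<lambda>x \<in> carrier E. c \<odot>\<^bsub>E\<^esub> T x)"
  "adj (adjointable_algebra E) T = (THE S. is_adjoint E T S)"
  by (simp_all add: adjointable_algebra_def)

lemma is_adjointD:
  assumes "is_adjoint E T S"
  shows "x \<in> carrier E \<Longrightarrow> T x \<in> carrier E" "x \<in> carrier E \<Longrightarrow> S x \<in> carrier E"
    and "T \<in> extensional (carrier E)" "S \<in> extensional (carrier E)"
    and "\<lbrakk>w \<in> carrier E; x \<in> carrier E; u \<in> carrier E\<rbrakk>
      \<Longrightarrow> tprod E (T w) x u = tprod E w (S x) u"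
  using assms by (auto simp: is_adjoint_def PiE_iff)

context admissible_star_tring
begin

text \<open>Under (a, u, -), associativity moves a product from the third slot into the middle one
  with its entries reversed. There the adjoint relation applies, and the result is moved
  back.\<close>

lemma is_adjoint_sym:
  assumes "is_adjoint E T S"
  shows "is_adjoint E S T"
proof -
  note TS = is_adjointD[OF assms]
  have "tprod E (S x) w b = tprod E x (T w) b"
    if [simp]: "x \<in> carrier E" "w \<in> carrier E" "b \<in> carrier E" for x w b
  proof (rule tprod_right_cancel)
    fix a u assume [simp]: "a \<in> carrier E" "u \<in> carrier E"
    have "tprod E a u (tprod E (S x) w b) = tprod E a (tprod E w (S x) u) b"
      by (simp add: tprod_assoc2 TS(2))
    also have "\<dots> = tprod E a (tprod E (T w) x u) b"
      by (simp add: TS)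
    also have "\<dots> = tprod E a u (tprod E x (T w) b)"
      by (simp add: tprod_assoc2 TS(1))
    finally show "tprod E a u (tprod E (S x) w b) = tprod E a u (tprod E x (T w) b)" .
  qed (simp_all add: TS tprod_closed)
  then show ?thesis
    using assms by (auto simp: is_adjoint_def)
qed

lemma is_adjoint_unique:
  assumes "is_adjoint E T S" "is_adjoint E T S'"
  shows "S = S'"
proof (rule extensionalityI[of _ "carrier E"])
  fix x assume "x \<in> carrier E"
  then show "S x = S' x"
    by - (rule tprod_middle_cancel, simp_all add: is_adjointD(2)[OF assms(1)]
      is_adjointD(2)[OF assms(2)] flip: is_adjointD(5)[OF assms(1)] is_adjointD(5)[OF assms(2)])
qed (rule is_adjointD(4)[OF assms(1)] is_adjointD(4)[OF assms(2)])+

lemma the_adjoint: "is_adjoint E T S \<Longrightarrow> (THE S. is_adjoint E T S) = S"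
  using is_adjoint_unique by blast

text \<open>Linearity comes from having an adjoint: by symmetry (a, T x, b) = (S a, x, b), whose
  right side is conjugate linear in x, and the middle variable can be cancelled.\<close>

lemma is_adjoint_add:
  assumes T: "is_adjoint E T S" and "x \<in> carrier E" "y \<in> carrier E"
  shows "T (x \<oplus> y) = T x \<oplus> T y"
proof -
  note ST = is_adjointD[OF is_adjoint_sym[OF T]]
  show ?thesis
    by (rule tprod_middle_cancel) (simp_all add: assms(2,3) ST(1,2) tprod_add2 flip: ST(5))
qed

lemma is_adjoint_smult:
  assumes T: "is_adjoint E T S" and "x \<in> carrier E"
  shows "T (c \<odot> x) = c \<odot> T x"
proof -
  note ST = is_adjointD[OF is_adjoint_sym[OF T]]
  show ?thesis
    by (rule tprod_middle_cancel) (simp_all add: assms(2) ST(1,2) tprod_smult2 flip: ST(5))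
qed

text \<open>\<open>T\<close> commutes with left multiplications. Moving \<open>T\<close> across to
  \<open>S\<close> on the outer entry frees the inner product for associativity. This later yields
  \<langle>y, z\<rangle> T = \<langle>y, z T\<rangle>.\<close>

lemma is_adjoint_tprod:
  assumes T: "is_adjoint E T S" and [simp]: "x \<in> carrier E" "y \<in> carrier E" "z \<in> carrier E"
  shows "T (tprod E x y z) = tprod E x y (T z)"
proof (rule tprod_middle_cancel)
  note ST = is_adjointD[OF is_adjoint_sym[OF T]]
  fix a b assume [simp]: "a \<in> carrier E" "b \<in> carrier E"
  have "tprod E a (T (tprod E x y z)) b = tprod E (S a) (tprod E x y z) b"
    by (simp add: ST tprod_closed)
  also have "\<dots> = tprod E (tprod E (S a) z y) x b"
    by (simp add: ST(1) tprod_assoc1)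
  also have "\<dots> = tprod E (tprod E a (T z) y) x b"
    by (simp add: ST)
  also have "\<dots> = tprod E a (tprod E x y (T z)) b"
    by (simp add: ST(2) tprod_assoc1)
  finally show "tprod E a (T (tprod E x y z)) b = tprod E a (tprod E x y (T z)) b" .
qed (simp_all add: is_adjointD(1)[OF T] tprod_closed)

lemma is_adjoint_zero: "is_adjoint E (\<lambda>x \<in> carrier E. \<zero>) (\<lambda>x \<in> carrier E. \<zero>)"
  by (auto simp: is_adjoint_def tprod_zero1 tprod_zero2)

lemma is_adjoint_plus:
  assumes "is_adjoint E T S" "is_adjoint E T' S'"
  shows "is_adjoint E (\<lambda>x \<in> carrier E. T x \<oplus> T' x) (\<lambda>x \<in> carrier E. S x \<oplus> S' x)"
  using is_adjointD[OF assms(1)] is_adjointD[OF assms(2)]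
  by (auto simp: is_adjoint_def tprod_add1 tprod_add2)

lemma is_adjoint_scale:
  assumes "is_adjoint E T S"
  shows "is_adjoint E (\<lambda>x \<in> carrier E. c \<odot> T x) (\<lambda>x \<in> carrier E. cnj c \<odot> S x)"
  using is_adjointD[OF assms]
  by (auto simp: is_adjoint_def tprod_smult1 tprod_smult2)

lemma is_adjoint_comp:
  assumes "is_adjoint E T S" "is_adjoint E T' S'"
  shows "is_adjoint E (\<lambda>x \<in> carrier E. T' (T x)) (\<lambda>x \<in> carrier E. S (S' x))"
  using is_adjointD[OF assms(1)] is_adjointD[OF assms(2)]
  by (auto simp: is_adjoint_def)

text \<open>This is exactly the first associativity law ((w, y, z), x, u) = (w, (x, z, y),
  u).\<close>

lemma is_adjoint_right_mult:
  assumes "y \<in> carrier E" "z \<in> carrier E"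
  shows "is_adjoint E (right_mult E y z) (right_mult E z y)"
  using assms by (auto simp: is_adjoint_def right_mult_def tprod_closed tprod_assoc1)

lemma module_adjointable_algebra: "module complex_ring (adjointable_algebra E)"
proof (rule moduleI)
  show "cring complex_ring" by (rule cring_from_type_algebra)
next
  show "abelian_group (adjointable_algebra E)"
  proof (rule abelian_groupI)
    fix T assume "T \<in> carrier (adjointable_algebra E)"
    then obtain S where T: "is_adjoint E T S" by auto
    \<comment> \<open>The additive inverse is obtained by scaling with -1, which keeps an
      adjoint.\<close>
    have "(\<lambda>x \<in> carrier E. (- 1) \<odot> T x) \<in> carrier (adjointable_algebra E)"
      using is_adjoint_scale[OF T] by auto
    then show "\<exists>U \<in> carrier (adjointable_algebra E).
        U \<oplus>\<^bsub>adjointable_algebra E\<^esub> T = \<zero>\<^bsub>adjointable_algebra E\<^esub>"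
      by (rule rev_bexI) (auto simp: is_adjointD[OF T] smult_minus_one l_neg)
    show "\<zero>\<^bsub>adjointable_algebra E\<^esub> \<oplus>\<^bsub>adjointable_algebra E\<^esub> T = T"
      using is_adjointD[OF T] by (intro extensionalityI[of _ "carrier E"]) auto
  qed (auto simp: is_adjointD(1) M.a_ac intro!: restrict_ext intro: is_adjoint_plus is_adjoint_zero)
next
  fix T assume "T \<in> carrier (adjointable_algebra E)"
  then obtain S where T: "is_adjoint E T S" by auto
  then show "\<one>\<^bsub>complex_ring\<^esub> \<odot>\<^bsub>adjointable_algebra E\<^esub> T = T"
    using is_adjointD[OF T] smult_one by (intro extensionalityI[of _ "carrier E"]) auto
qed (auto simp: is_adjointD(1) smult_add_scalar smult_mult_scalar smult_r_distr
    intro!: restrict_ext intro: is_adjoint_scale)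

lemma admissible_star_algebra_adjointable_algebra:
  "admissible_star_algebra (adjointable_algebra E)"
proof (intro admissible_star_algebra.intro admissible_star_algebra_axioms.intro star_algebra.intro
    star_algebra_axioms.intro module_adjointable_algebra)
  let ?A = "adjointable_algebra E"
  fix T assume "T \<in> carrier ?A"
  then obtain S where T: "is_adjoint E T S" by auto
  note TS = is_adjointD[OF T]
  \<comment> \<open>In this product \<open>T\<close> is applied after \<open>U\<close>, so linearity
    of the operator \<open>T\<close> itself is required.\<close>
  show "complex_linear ?A ?A (\<lambda>U. U \<otimes>\<^bsub>?A\<^esub> T)"
    by (auto simp: complex_linear_def is_adjointD(1) TS(1) is_adjoint_add[OF T] is_adjoint_smult[OF T]
      intro!: restrict_ext intro: is_adjoint_comp T)
  show "complex_linear ?A ?A (\<lambda>U. T \<otimes>\<^bsub>?A\<^esub> U)"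
    by (auto simp: complex_linear_def is_adjointD(1) TS(1) intro!: restrict_ext intro: is_adjoint_comp T)
  show "adj ?A (adj ?A T) = T"
    using the_adjoint[OF T] the_adjoint[OF is_adjoint_sym[OF T]] by simp
  {
    fix U assume "U \<in> carrier ?A"
    then obtain V where U: "is_adjoint E U V" by auto
    show "adj ?A (T \<otimes>\<^bsub>?A\<^esub> U) = adj ?A U \<otimes>\<^bsub>?A\<^esub> adj ?A T"
      using the_adjoint[OF T] the_adjoint[OF U] the_adjoint[OF is_adjoint_comp[OF T U]] by simp
    fix W assume "W \<in> carrier ?A"
    show "T \<otimes>\<^bsub>?A\<^esub> U \<otimes>\<^bsub>?A\<^esub> W = T \<otimes>\<^bsub>?A\<^esub> (U \<otimes>\<^bsub>?A\<^esub> W)"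
      using TS by (auto intro!: restrict_ext)
  }
  \<comment> \<open>Because of the reversed composition, this product is the operator x \<mapsto> T
    (S x).\<close>
  assume "adj ?A T \<otimes>\<^bsub>?A\<^esub> T = \<zero>\<^bsub>?A\<^esub>"
  then have zero: "T (S x) = \<zero>" if "x \<in> carrier E" for x
    using that the_adjoint[OF T] by (auto dest: fun_cong[of _ _ x])
  have S0: "S x = \<zero>" if "x \<in> carrier E" for x
  proof (rule tprod_eq_zero)
    show "tprod E (S x) (S x) (S x) = \<zero>"
      using TS(5)[of "S x" x "S x"] by (simp add: that TS zero tprod_zero1)
  qed (simp add: TS that)
  have "S = (\<lambda>x \<in> carrier E. \<zero>)"
    using TS S0 by (intro extensionalityI[of _ "carrier E"]) auto
  \<comment> \<open>\<open>T\<close> is an adjoint of \<open>S\<close> = 0, and so is the zero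
    operator.\<close>
  then show "T = \<zero>\<^bsub>?A\<^esub>"
    using is_adjoint_unique[OF is_adjoint_sym[OF T]] is_adjoint_zero by simp
next
  let ?A = "adjointable_algebra E"
  have "adj ?A (T \<oplus>\<^bsub>?A\<^esub> U) = adj ?A T \<oplus>\<^bsub>?A\<^esub> adj ?A U"
    if "is_adjoint E T S" "is_adjoint E U V" for T S U V
    using the_adjoint[OF is_adjoint_plus[OF that]] that[THEN the_adjoint] by simp
  moreover have "adj ?A (c \<odot>\<^bsub>?A\<^esub> T) = cnj c \<odot>\<^bsub>?A\<^esub> adj ?A T"
    if "is_adjoint E T S" for T S c
    using the_adjoint[OF is_adjoint_scale[OF that]] that[THEN the_adjoint] by simp
  moreover have "adj ?A T \<in> carrier ?A" if "is_adjoint E T S" for T S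
    using the_adjoint[OF that] is_adjoint_sym[OF that] by auto
  ultimately show "conjugate_linear ?A ?A (adj ?A)"
    unfolding conjugate_linear_def by (fastforce simp del: adjointable_algebra_simps(2-6))
qed

end

section \<open>The algebra spanned by the right multiplications\<close>

definition right_mults :: "'e star_tring \<Rightarrow> ('e \<Rightarrow> 'e) set"
  where "right_mults E = {right_mult E y z | y z. y \<in> carrier E \<and> z \<in> carrier E}"

lemma right_mults_memI:
  "\<lbrakk>y \<in> carrier E; z \<in> carrier E\<rbrakk> \<Longrightarrow> right_mult E y z \<in> right_mults E"
  by (auto simp: right_mults_def)

text \<open>A linear span suffices, since the right multiplications are closed under products and
  adjoints.\<close>

definition right_algebra :: "'e star_tring \<Rightarrow> ('e \<Rightarrow> 'e) star_algebra"
  where "right_algebra E =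
    (adjointable_algebra E)\<lparr>carrier := complex_span (adjointable_algebra E) (right_mults E)\<rparr>"

context admissible_star_tring
begin

lemma right_mults_subset: "right_mults E \<subseteq> carrier (adjointable_algebra E)"
  using is_adjoint_right_mult by (auto simp: right_mults_def)

lemma right_mult_mem_right_algebra:
  "\<lbrakk>y \<in> carrier E; z \<in> carrier E\<rbrakk> \<Longrightarrow> right_mult E y z \<in> carrier (right_algebra E)"
  unfolding right_algebra_def complex_span_def by (simp add: hull_inc right_mults_memI)

lemma adj_right_mult:
  "\<lbrakk>y \<in> carrier E; z \<in> carrier E\<rbrakk>
    \<Longrightarrow> adj (adjointable_algebra E) (right_mult E y z) = right_mult E z y"
  using the_adjoint[OF is_adjoint_right_mult] by simp

lemma right_mult_mult:
  assumes "is_adjoint E T S" "y \<in> carrier E" "z \<in> carrier E"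
  shows "right_mult E y z \<otimes>\<^bsub>adjointable_algebra E\<^esub> T = right_mult E y (T z)"
  using assms by (auto simp: right_mult_def is_adjoint_tprod intro!: restrict_ext)

lemma admissible_star_algebra_right_algebra: "admissible_star_algebra (right_algebra E)"
proof -
  interpret M: admissible_star_algebra "adjointable_algebra E"
    by (rule admissible_star_algebra_adjointable_algebra)
  have "star_algebra (right_algebra E)"
    unfolding right_algebra_def
  proof (rule M.star_algebra_span[OF right_mults_subset])
    fix T U assume "T \<in> right_mults E" "U \<in> right_mults E"
    then obtain y z u v where *: "T = right_mult E y z" "U = right_mult E u v"
        and [simp]: "y \<in> carrier E" "z \<in> carrier E" "u \<in> carrier E" "v \<in> carrier E"
      by (auto simp: right_mults_def)
    have "T \<otimes>\<^bsub>adjointable_algebra E\<^esub> U = right_mult E y (tprod E z u v)"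
      unfolding * by (subst right_mult_mult[OF is_adjoint_right_mult]) (simp_all add: right_mult_def)
    also have "\<dots> \<in> right_mults E"
      by (rule right_mults_memI) (simp_all add: tprod_closed)
    finally show "T \<otimes>\<^bsub>adjointable_algebra E\<^esub> U \<in> complex_span (adjointable_algebra E) (right_mults E)"
      by (rule M.span_superset)
  next
    fix T assume "T \<in> right_mults E"
    then obtain y z where "T = right_mult E y z" "y \<in> carrier E" "z \<in> carrier E"
      by (auto simp: right_mults_def)
    then have "adj (adjointable_algebra E) T \<in> right_mults E"
      by (simp only: adj_right_mult right_mults_memI)
    then show "adj (adjointable_algebra E) T \<in> complex_span (adjointable_algebra E) (right_mults E)"
      by (rule M.span_superset)
  qed
  then show ?thesis
    unfolding right_algebra_def by (rule M.admissible_star_algebra_span[OF right_mults_subset])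
qed

text \<open>Operators act by evaluation, and \<langle>y, z\<rangle> is right multiplication by the
  pair y, z, so x\<langle>y, z\<rangle> = (x, y, z) holds by definition.\<close>

lemma adm_full_triple_right_algebra:
  "adm_full_triple_of E (right_algebra E) (\<lambda>x T. T x) (right_mult E)"
proof -
  let ?A = "right_algebra E"
  interpret M: admissible_star_algebra "adjointable_algebra E"
    by (rule admissible_star_algebra_adjointable_algebra)
  interpret A: admissible_star_algebra ?A
    by (rule admissible_star_algebra_right_algebra)
  have ops: "x \<oplus>\<^bsub>?A\<^esub> y = x \<oplus>\<^bsub>adjointable_algebra E\<^esub> y" "x \<otimes>\<^bsub>?A\<^esub> y = x \<otimes>\<^bsub>adjointable_algebra E\<^esub> y"
    "c \<odot>\<^bsub>?A\<^esub> x = c \<odot>\<^bsub>adjointable_algebra E\<^esub> x" "adj ?A x = adj (adjointable_algebra E) x" for x y c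
    by (simp_all add: right_algebra_def)
  have ex: "\<exists>S. is_adjoint E T S" if "T \<in> carrier ?A" for T
    using that M.span_subset_carrier[OF right_mults_subset] by (auto simp: right_algebra_def)
  have "basic_triple E ?A (\<lambda>x T. T x) (right_mult E)"
  proof (intro basic_triple.intro basic_triple_axioms.intro module_axioms A.star_algebra_axioms)
    fix T assume "T \<in> carrier ?A"
    then obtain S where T: "is_adjoint E T S" using ex by blast
    show "complex_linear E E (\<lambda>x. T x)"
      using is_adjointD[OF T] is_adjoint_add[OF T] is_adjoint_smult[OF T]
      by (auto simp: complex_linear_def)
    fix x y assume "x \<in> carrier E" "y \<in> carrier E"
    then show "right_mult E x y \<otimes>\<^bsub>?A\<^esub> T = right_mult E x (T y)"
      unfolding ops by (rule right_mult_mult[OF T])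
  next
    fix x assume x: "x \<in> carrier E"
    show "complex_linear ?A E (\<lambda>T. T x)"
      using x ex by (auto simp: complex_linear_def ops dest: is_adjointD)
    show "U (T x) = (T \<otimes>\<^bsub>?A\<^esub> U) x" for T U
      using x by (simp add: ops)
    show "conjugate_linear E ?A (\<lambda>y. right_mult E y x)"
      using x right_mult_mem_right_algebra
      by (auto simp: conjugate_linear_def ops right_mult_def tprod_add2 tprod_smult2 intro!: restrict_ext)
    show "complex_linear E ?A (right_mult E x)"
      using x right_mult_mem_right_algebra
      by (auto simp: complex_linear_def ops right_mult_def tprod_add3 tprod_smult3 intro!: restrict_ext)
  qed (simp add: ops adj_right_mult del: adjointable_algebra_simps)
  \<comment> \<open>Fullness concerns the span formed inside \<open>?A\<close>, not inside the
    algebra of all adjointable operators.\<close>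
  moreover have "complex_span ?A (right_mults E) = carrier ?A"
    using M.span_in_span[OF right_mults_subset] by (simp add: right_algebra_def)
  ultimately show ?thesis
    using A.admissible_star_algebra_axioms
    by (auto simp: adm_full_triple_of_def admissible_basic_triple_def full_basic_triple_def
        full_basic_triple_axioms_def associated_tprod_def right_mult_def right_mults_def
        admissible_star_algebra_def)
qed

end


section \<open>Functoriality and uniqueness\<close>

text \<open>Uniqueness of the pair is functoriality applied to the identity.\<close>

lemma (in star_tring) tring_hom_id: "star_tring_hom E E (\<lambda>x. x)"
  by (simp add: star_tring_hom_def complex_linear_def)

locale admissible_full_triple =
  admissible_basic_triple E A act ip + full_basic_triple E A act ip
  for E :: "(complex, 'e, 'm) module_scheme" and A :: "'a star_algebra" and act ip
begin

abbreviation ips :: "'a set"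
  where "ips \<equiv> {ip x y | x y. x \<in> carrier E \<and> y \<in> carrier E}"

lemma ip_closed: "\<lbrakk>x \<in> carrier E; y \<in> carrier E\<rbrakk> \<Longrightarrow> ip x y \<in> carrier A"
  using complex_linearD(1)[OF ip_linear2] .

lemma ips_subset: "ips \<subseteq> carrier A"
  using ip_closed by auto

lemmas act_closed = complex_linearD(1)[OF act_linear1]
  and act_add = complex_linearD(2)[OF act_linear2]
  and act_smult = complex_linearD(3)[OF act_linear2]
  and act_zero = linear_zero[OF A.module_axioms E.module_axioms disjI1, OF act_linear2]

end

lemma admissible_full_triple_of:
  "adm_full_triple_of E A act ip \<Longrightarrow> admissible_full_triple E A act ip"
  by (simp add: adm_full_triple_of_def admissible_full_triple_def)

lemma act_ip:
  "\<lbrakk>adm_full_triple_of E A act ip; x \<in> carrier E; y \<in> carrier E; z \<in> carrier E\<rbrakk>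
    \<Longrightarrow> act x (ip y z) = tprod E x y z"
  by (simp add: adm_full_triple_of_def associated_tprod_def)

section \<open>The algebra homomorphism induced by a homomorphism of ternary rings\<close>

locale triple_pair =
  A: admissible_full_triple E A actA ipA + B: admissible_full_triple F B actB ipB
  for E :: "'e star_tring" and A :: "'a star_algebra" and actA ipA
    and F :: "'f star_tring" and B :: "'b star_algebra" and actB ipB +
  fixes \<pi> :: "'e \<Rightarrow> 'f"
  assumes hom: "star_tring_hom E F \<pi>"
    and tripleA: "adm_full_triple_of E A actA ipA"
    and tripleB: "adm_full_triple_of F B actB ipB"
begin

lemma \<pi>_linear: "complex_linear E F \<pi>"
  using hom by (simp add: star_tring_hom_def)

lemmas \<pi>_closed = complex_linearD(1)[OF \<pi>_linear]
  and \<pi>_add = complex_linearD(2)[OF \<pi>_linear]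
  and \<pi>_smult = complex_linearD(3)[OF \<pi>_linear]
  and \<pi>_zero = linear_zero[OF A.E.module_axioms B.E.module_axioms disjI1, OF \<pi>_linear]

lemma \<pi>_act_ip:
  "\<lbrakk>x \<in> carrier E; y \<in> carrier E; z \<in> carrier E\<rbrakk>
    \<Longrightarrow> \<pi> (actA x (ipA y z)) = actB (\<pi> x) (ipB (\<pi> y) (\<pi> z))"
  using hom by (simp add: act_ip[OF tripleA] act_ip[OF tripleB] \<pi>_closed star_tring_hom_def)

definition intertwines :: "('a \<Rightarrow> 'b) \<Rightarrow> bool"
  where "intertwines \<psi> \<longleftrightarrow> star_algebra_hom A B \<psi> \<and>
    (\<forall>x \<in> carrier E. \<forall>y \<in> carrier E. \<psi> (ipA x y) = ipB (\<pi> x) (\<pi> y))"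

text \<open>By fullness, a linear map on \<open>A\<close> is determined by its values on the
  elements \<langle>x, y\<rangle>.\<close>

lemma intertwines_unique:
  assumes "intertwines \<psi>" "intertwines \<psi>'" "a \<in> carrier A"
  shows "\<psi> a = \<psi>' a"
proof (rule linear_eq_on_span[OF A.A.module_axioms B.A.module_axioms _ _ A.ips_subset])
  show "complex_linear A B \<psi>" "complex_linear A B \<psi>'"
    using assms by (auto simp: intertwines_def star_algebra_hom_def)
  show "a \<in> complex_span A A.ips"
    using assms A.full by simp
qed (use assms in \<open>auto simp: intertwines_def\<close>)

text \<open>The image of a combination of elements \<langle>x, y\<rangle> might depend on how it is
  written. The linear span of the pairs in the product of \<open>A\<close> and \<open>B\<close>
  avoids this choice; single-valuedness is proved afterwards.\<close>

inductive graph :: "'a \<Rightarrow> 'b \<Rightarrow> bool" where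
  ip: "\<lbrakk>x \<in> carrier E; y \<in> carrier E\<rbrakk> \<Longrightarrow> graph (ipA x y) (ipB (\<pi> x) (\<pi> y))"
| zero: "graph \<zero>\<^bsub>A\<^esub> \<zero>\<^bsub>B\<^esub>"
| add: "\<lbrakk>graph a b; graph a' b'\<rbrakk> \<Longrightarrow> graph (a \<oplus>\<^bsub>A\<^esub> a') (b \<oplus>\<^bsub>B\<^esub> b')"
| smult: "graph a b \<Longrightarrow> graph (c \<odot>\<^bsub>A\<^esub> a) (c \<odot>\<^bsub>B\<^esub> b)"

lemma graph_closed: "graph a b \<Longrightarrow> a \<in> carrier A \<and> b \<in> carrier B"
  by (induction rule: graph.induct) (simp_all add: A.ip_closed B.ip_closed \<pi>_closed)

text \<open>On generators this is preservation of the ternary product, and both sides are linear in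
  the related pair. It drives multiplicativity, single-valuedness and compatibility with the
  actions.\<close>

lemma graph_act: "graph a b \<Longrightarrow> x \<in> carrier E \<Longrightarrow> \<pi> (actA x a) = actB (\<pi> x) b"
proof (induction rule: graph.induct)
  case (add a b a' b')
  then show ?case
    by (simp add: A.act_add B.act_add \<pi>_add A.act_closed \<pi>_closed graph_closed)
next
  case (smult a b c)
  then show ?case
    by (simp add: A.act_smult B.act_smult \<pi>_smult A.act_closed \<pi>_closed graph_closed)
qed (simp_all add: \<pi>_act_ip A.act_zero B.act_zero \<pi>_zero \<pi>_closed)

lemma graph_total: "a \<in> carrier A \<Longrightarrow> \<exists>b. graph a b"
proof -
  assume "a \<in> carrier A"
  then have "a \<in> complex_span A A.ips" by (simp add: A.full)
  from this A.ips_subset show ?thesis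
    by (induction rule: A.A.span_induct) (auto intro: graph.intros)
qed

lemma graph_adj: "graph a b \<Longrightarrow> graph (adj A a) (adj B b)"
proof (induction rule: graph.induct)
  case (ip x y)
  then show ?case by (simp add: A.adj_ip B.adj_ip \<pi>_closed graph.ip)
next
  case zero
  then show ?case by (simp add: A.A.adj_zero B.A.adj_zero graph.zero)
next
  case (add a b a' b')
  then show ?case by (simp add: A.A.adj_add B.A.adj_add graph_closed graph.add)
next
  case (smult a b c)
  then show ?case by (simp add: A.A.adj_smult B.A.adj_smult graph_closed graph.smult)
qed

text \<open>Only the left factor needs induction: \<langle>x, y\<rangle> a' = \<langle>x, y
  a'\<rangle>, and \<open>graph_act\<close> evaluates \<pi> at y a', so the product of a generator
  with a' is again a generator.\<close>

lemma graph_mult: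
  assumes "graph a b" and ab': "graph a' b'"
  shows "graph (a \<otimes>\<^bsub>A\<^esub> a') (b \<otimes>\<^bsub>B\<^esub> b')"
  using assms(1)
proof (induction rule: graph.induct)
  case (ip x y)
  then have "graph (ipA x (actA y a')) (ipB (\<pi> x) (\<pi> (actA y a')))"
    using ab' by (intro graph.ip) (simp_all add: A.act_closed graph_closed)
  then show ?case
    using ip ab' by (simp add: A.ip_act B.ip_act graph_act graph_closed \<pi>_closed)
next
  case zero
  then show ?case
    using ab' by (simp add: A.A.mult_zero_left B.A.mult_zero_left graph_closed graph.zero)
next
  case (add a b a'' b'')
  then show ?case
    using ab' by (simp add: A.A.mult_add_left B.A.mult_add_left graph_closed graph.add)
next
  case (smult a b c)
  then show ?case
    using ab' by (simp add: A.A.mult_smult_left B.A.mult_smult_left graph_closed graph.smult)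
qed

text \<open>
  If \<open>0\<close> is related to \<open>b\<close>, then \<open>b\<close> annihilates \<open>\<pi> x\<close> for every \<open>x\<close>, hence
  \<open>\<langle>\<pi> x, \<pi> y\<rangle> b = \<langle>\<pi> x, \<pi> y b\<rangle> = 0\<close>. As \<open>b\<^sup>*\<close> is a combination of such elements, \<open>b\<^sup>* b = 0\<close>.
\<close>

lemma graph_zero_left:
  assumes b: "graph \<zero>\<^bsub>A\<^esub> b"
  shows "b = \<zero>\<^bsub>B\<^esub>"
proof -
  have bB: "b \<in> carrier B" using graph_closed[OF b] ..
  have act0: "actB (\<pi> x) b = \<zero>\<^bsub>F\<^esub>" if "x \<in> carrier E" for x
    using graph_act[OF b that] that by (simp add: A.act_zero \<pi>_zero)
  have ip0: "ipB x \<zero>\<^bsub>F\<^esub> = \<zero>\<^bsub>B\<^esub>" if "x \<in> carrier F" for x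
    using linear_zero[OF B.E.module_axioms B.A.module_axioms disjI1, OF B.ip_linear2[OF that]] .
  have "c \<otimes>\<^bsub>B\<^esub> b = \<zero>\<^bsub>B\<^esub>" if "graph a c" for a c
    using that
    by (induction rule: graph.induct)
      (simp_all add: B.ip_act bB \<pi>_closed act0 ip0 B.A.mult_zero_left B.A.mult_add_left
        B.A.mult_smult_left graph_closed)
  from this[OF graph_adj[OF b]] show ?thesis
    by (rule B.A.adj_mult_self_eq_zero[OF bB])
qed

text \<open>By linearity of the relation, 0 is related to b - b', which reduces the claim to
  \<open>graph_zero_left\<close>.\<close>

lemma graph_unique:
  assumes b: "graph a b" and b': "graph a b'"
  shows "b = b'"
proof -
  have "graph (a \<oplus>\<^bsub>A\<^esub> (- 1) \<odot>\<^bsub>A\<^esub> a) (b \<oplus>\<^bsub>B\<^esub> (- 1) \<odot>\<^bsub>B\<^esub> b')"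
    using b b' by (intro graph.intros)
  then have "b \<oplus>\<^bsub>B\<^esub> (- 1) \<odot>\<^bsub>B\<^esub> b' = \<zero>\<^bsub>B\<^esub>"
    using graph_closed[OF b]
    by (intro graph_zero_left) (simp add: A.A.smult_minus_one A.A.r_neg)
  then show ?thesis
    using graph_closed[OF b] graph_closed[OF b']
    by - (rule B.A.eq_if_diff_eq_zero, simp_all add: B.A.smult_minus_one a_minus_def)
qed

text \<open>Restriction to the carrier singles out one representative among functions that agree on
  \<open>A\<close>.\<close>

definition induced :: "'a \<Rightarrow> 'b"
  where "induced = (\<lambda>a \<in> carrier A. THE b. graph a b)"

lemma graph_iff: "graph a b \<longleftrightarrow> a \<in> carrier A \<and> induced a = b"
proof
  assume "graph a b"
  then show "a \<in> carrier A \<and> induced a = b"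
    using graph_unique graph_closed by (auto simp: induced_def)
next
  assume "a \<in> carrier A \<and> induced a = b"
  moreover from this obtain b' where "graph a b'"
    using graph_total by blast
  then have "graph a (THE b. graph a b)"
    by (rule theI) (simp add: graph_unique[OF _ \<open>graph a b'\<close>])
  ultimately show "graph a b"
    by (auto simp: induced_def)
qed

lemma intertwines_induced: "intertwines induced"
proof -
  have graph: "graph a (induced a)" if "a \<in> carrier A" for a
    using that by (simp add: graph_iff)
  have eq: "induced a = b" if "graph a b" for a b
    using that by (simp add: graph_iff)
  show ?thesis
    unfolding intertwines_def star_algebra_hom_def complex_linear_def
    \<comment> \<open>Each closure property of the relation becomes a preservation property of the
      function through \<open>eq\<close>.\<close>
    by (auto intro!: eq graph.intros graph graph_mult graph_adj dest: graph_closed[OF graph])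
qed

text \<open>Any intertwiner agrees with \<open>induced\<close> on \<open>A\<close>, so its values
  are related to their arguments and \<open>graph_act\<close> applies.\<close>

lemma intertwines_act:
  assumes \<psi>: "intertwines \<psi>" and "x \<in> carrier E" "a \<in> carrier A"
  shows "\<pi> (actA x a) = actB (\<pi> x) (\<psi> a)"
  using graph_act[of a "\<psi> a" x] intertwines_unique[OF \<psi> intertwines_induced] assms
  by (simp add: graph_iff)

end

lemma triple_pairI:
  assumes "star_tring_hom E F \<pi>" "adm_full_triple_of E A actA ipA" "adm_full_triple_of F B actB ipB"
  shows "triple_pair E A actA ipA F B actB ipB \<pi>"
  using assms
  by (intro triple_pair.intro triple_pair_axioms.intro admissible_full_triple_of)

lemma (in star_tring) canonical_iso_exists:
  assumes A: "adm_full_triple_of E A actA ipA" and B: "adm_full_triple_of E B actB ipB"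
  shows "\<exists>\<psi>. canonical_iso E A actA ipA B actB ipB \<psi>"
proof -
  interpret AB: triple_pair E A actA ipA E B actB ipB "\<lambda>x. x"
    using tring_hom_id A B by (rule triple_pairI)
  interpret BA: triple_pair E B actB ipB E A actA ipA "\<lambda>x. x"
    using tring_hom_id B A by (rule triple_pairI)
  \<comment> \<open>For the identity, the rules generating the two relations are mirror images, so
    the relations are converse to each other and the induced maps are mutually inverse.\<close>
  have flip: "BA.graph b a" if "AB.graph a b" for a b
    using that by (induction rule: AB.graph.induct) (auto intro: BA.graph.intros)
  have flip': "AB.graph a b" if "BA.graph b a" for a b
    using that by (induction rule: BA.graph.induct) (auto intro: AB.graph.intros)
  have "bij_betw AB.induced (carrier A) (carrier B)"
    by (rule bij_betw_byWitness[of _ BA.induced])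
      (use flip flip' in \<open>auto simp: AB.graph_iff BA.graph_iff\<close>)
  then have "canonical_iso E A actA ipA B actB ipB AB.induced"
    using AB.intertwines_induced AB.intertwines_act
    by (auto simp: canonical_iso_def AB.intertwines_def)
  then show ?thesis by blast
qed

theorem theorem2p10:
  fixes E :: "'e star_tring" and F :: "'f star_tring"
  assumes "admissible_star_tring E" and "admissible_star_tring F"
  shows
    "(\<exists>(A :: ('e \<Rightarrow> 'e) star_algebra) act ip. adm_full_triple_of E A act ip) \<and>
     (\<forall>\<pi> (A :: 'a star_algebra) actA ipA (B :: 'b star_algebra) actB ipB.
        star_tring_hom E F \<pi> \<longrightarrow>
        adm_full_triple_of E A actA ipA \<longrightarrow>
        adm_full_triple_of F B actB ipB \<longrightarrow>
          (\<exists>!\<psi>. \<psi> \<in> extensional (carrier A) \<and> star_algebra_hom A B \<psi> \<and>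
            (\<forall>x \<in> carrier E. \<forall>y \<in> carrier E. \<psi> (ipA x y) = ipB (\<pi> x) (\<pi> y))) \<and>
          (\<forall>\<psi>. star_algebra_hom A B \<psi> \<and>
            (\<forall>x \<in> carrier E. \<forall>y \<in> carrier E. \<psi> (ipA x y) = ipB (\<pi> x) (\<pi> y)) \<longrightarrow>
              (\<forall>x \<in> carrier E. \<forall>b \<in> carrier A. \<pi> (actA x b) = actB (\<pi> x) (\<psi> b)) \<and>
              basic_triple_hom E A actA F B actB \<pi> \<psi>)) \<and>
     (\<forall>(A :: 'a star_algebra) actA ipA (A' :: 'c star_algebra) actA' ipA'.
        adm_full_triple_of E A actA ipA \<longrightarrow>
        adm_full_triple_of E A' actA' ipA' \<longrightarrow>
          (\<exists>\<psi>. canonical_iso E A actA ipA A' actA' ipA' \<psi>))"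
proof (intro conjI allI impI)
  show "\<exists>(A :: ('e \<Rightarrow> 'e) star_algebra) act ip. adm_full_triple_of E A act ip"
    using admissible_star_tring.adm_full_triple_right_algebra[OF assms(1)] by blast
next
  fix \<pi> and A :: "'a star_algebra" and actA ipA and B :: "'b star_algebra" and actB ipB
  assume "star_tring_hom E F \<pi>" "adm_full_triple_of E A actA ipA" "adm_full_triple_of F B actB ipB"
  then interpret triple_pair E A actA ipA F B actB ipB \<pi>
    by (rule triple_pairI)
  show "\<exists>!\<psi>. \<psi> \<in> extensional (carrier A) \<and> star_algebra_hom A B \<psi> \<and>
      (\<forall>x \<in> carrier E. \<forall>y \<in> carrier E. \<psi> (ipA x y) = ipB (\<pi> x) (\<pi> y))"
    unfolding intertwines_def[symmetric]
  proof (rule ex1I[of _ induced])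
    show "induced \<in> extensional (carrier A) \<and> intertwines induced"
      using intertwines_induced by (simp add: induced_def)
    \<comment> \<open>The two maps agree on \<open>A\<close> by fullness and outside it by
      extensionality.\<close>
    then show "\<psi> = induced" if "\<psi> \<in> extensional (carrier A) \<and> intertwines \<psi>" for \<psi>
      using that intertwines_unique by (blast intro: extensionalityI)
  qed
  fix \<psi>
  assume "star_algebra_hom A B \<psi> \<and>
    (\<forall>x \<in> carrier E. \<forall>y \<in> carrier E. \<psi> (ipA x y) = ipB (\<pi> x) (\<pi> y))"
  then have \<psi>: "intertwines \<psi>" by (simp add: intertwines_def)
  then show "basic_triple_hom E A actA F B actB \<pi> \<psi>"
    using intertwines_act[OF \<psi>] \<pi>_linear by (simp add: basic_triple_hom_def intertwines_def)
  show "\<forall>x \<in> carrier E. \<forall>b \<in> carrier A. \<pi> (actA x b) = actB (\<pi> x) (\<psi> b)"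
    using intertwines_act[OF \<psi>] by simp
next
  fix A :: "'a star_algebra" and actA ipA and A' :: "'c star_algebra" and actA' ipA'
  assume "adm_full_triple_of E A actA ipA" "adm_full_triple_of E A' actA' ipA'"
  then show "\<exists>\<psi>. canonical_iso E A actA ipA A' actA' ipA' \<psi>"
    using star_tring.canonical_iso_exists[OF admissible_star_tring.axioms(1)[OF assms(1)]] by blast
qed

end
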